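(* Let $m>2$ and $k$ be integers with $0<k<2^m$, and let $N=k\cdot 2^m+1$. Suppose that one of the following holds: (i) $k \equiv 1 \pmod{6}$, $k \equiv 1,7 \pmod{10}$ and $m \equiv 0 \pmod{4}$; (ii) $k \equiv 5 \pmod{6}$, $k \equiv 1,3 \pmod{10}$ and $m \equiv 1 \pmod{4}$; (iii) $k \equiv 1 \pmod{6}$, $k \equiv 3,9 \pmod{10}$ and $m \equiv 2 \pmod{4}$; (iv) $k \equiv 5 \pmod{6}$, $k \equiv 7,9 \pmod{10}$ and $m \equiv 3 \pmod{4}$. Let $x=V_k(8,1)$. Then $N$ is prime if and only if $N \mid S_{m-2}(x)$.
   Context: For $P,Q\in\mathbb{Z}$ the Lucas sequence $\{V_n(P,Q)\}$ is defined by $V_0(P,Q)=2$, $V_1(P,Q)=P$, $V_{n+1}(P,Q)=PV_n(P,Q)-QV_{n-1}(P,Q)$ for $n\ge 1$. For an integer $x$, the sequence $S_n(x)$ is defined by $S_0(x)=x$ and $S_{j+1}(x)=(S_j(x))^2-2$ for $j\ge 0$. *)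

theory Defs
  imports "HOL-Number_Theory.Number_Theory"
begin

fun lucas_V :: "int \<Rightarrow> int \<Rightarrow> nat \<Rightarrow> int" where
  "lucas_V P Q 0 = 2"
| "lucas_V P Q (Suc 0) = P"
| "lucas_V P Q (Suc (Suc n)) = P * lucas_V P Q (Suc n) - Q * lucas_V P Q n"

primrec S_seq :: "int \<Rightarrow> nat \<Rightarrow> int" where
  "S_seq x 0 = x"
| "S_seq x (Suc j) = (S_seq x j)^2 - 2"

end

(* Let \<alpha> = 4 + \<surd>15, a unit of norm 1 with 10 \<alpha> = (5 + \<surd>15)^2. Since V_n(8,1) = \<alpha>^n + \<alpha>^(-n), the
   divisibility N | S_(m-2)(x) says that \<alpha>^((N-1)/2) = -1 modulo N. The congruence conditions on k
   and m say that N = 2 modulo 3 and N = 2 or 3 modulo 5. If N is prime, quadratic reciprocity then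
   makes 3 and 5 nonresidues, while 2 is a residue; hence 15^((N-1)/2) = 1 and 10^((N-1)/2) = -1,
   Frobenius fixes 5 + \<surd>15, and (10 \<alpha>)^((N-1)/2) = (5 + \<surd>15)^(N-1) = 1.
   Conversely, modulo each prime p | N the Frobenius map sends \<alpha> to \<alpha> or to its inverse, so the
   order of \<alpha> divides p - 1 or p + 1; as 2^m divides this order, p = 1 or -1 modulo 2^m. A composite
   N < 2^(2m) would then have p = 2^m - 1 as a factor, which is impossible for odd k < 2^m. *)

theory Submission
  imports Defs
begin

section \<open>The ring of integer combinations of 1 and the square root of 15\<close>

text \<open>No infinite object is meant: a codatatype lets \<open>primcorec\<close> define the ring
  operations by their two coordinates.\<close>

codatatype zsqrt15 = ZSqrt15 (rat_part: int) (sqrt_part: int)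

lemma zsqrt15_eq_iff: "x = y \<longleftrightarrow> rat_part x = rat_part y \<and> sqrt_part x = sqrt_part y"
  by (auto intro: zsqrt15.expand)

instantiation zsqrt15 :: comm_ring_1
begin

primcorec zero_zsqrt15 :: zsqrt15 where
  "rat_part 0 = 0"
| "sqrt_part 0 = 0"

primcorec one_zsqrt15 :: zsqrt15 where
  "rat_part 1 = 1"
| "sqrt_part 1 = 0"

primcorec plus_zsqrt15 :: "zsqrt15 \<Rightarrow> zsqrt15 \<Rightarrow> zsqrt15" where
  "rat_part (x + y) = rat_part x + rat_part y"
| "sqrt_part (x + y) = sqrt_part x + sqrt_part y"

primcorec uminus_zsqrt15 :: "zsqrt15 \<Rightarrow> zsqrt15" where
  "rat_part (- x) = - rat_part x"
| "sqrt_part (- x) = - sqrt_part x"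

primcorec minus_zsqrt15 :: "zsqrt15 \<Rightarrow> zsqrt15 \<Rightarrow> zsqrt15" where
  "rat_part (x - y) = rat_part x - rat_part y"
| "sqrt_part (x - y) = sqrt_part x - sqrt_part y"

primcorec times_zsqrt15 :: "zsqrt15 \<Rightarrow> zsqrt15 \<Rightarrow> zsqrt15" where
  "rat_part (x * y) = rat_part x * rat_part y + 15 * (sqrt_part x * sqrt_part y)"
| "sqrt_part (x * y) = rat_part x * sqrt_part y + sqrt_part x * rat_part y"

instance
  by standard (simp_all add: zsqrt15_eq_iff algebra_simps)

end

lemma of_nat_zsqrt15: "of_nat n = ZSqrt15 (int n) 0"
  by (induction n) (simp_all add: zsqrt15_eq_iff)

lemma of_int_zsqrt15: "of_int n = ZSqrt15 n 0"
  by (simp add: zsqrt15_eq_iff of_int_of_nat of_nat_zsqrt15)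

text \<open>Comparing rational parts in b = a z suffices. Congruences of integers thus move to the
  ring and back, and no quotient ring has to be built.\<close>

lemma of_int_dvd_of_int_zsqrt15_iff:
  "(of_int a :: zsqrt15) dvd of_int b \<longleftrightarrow> a dvd b"
proof
  assume "(of_int a :: zsqrt15) dvd of_int b"
  then obtain z :: zsqrt15 where "of_int b = of_int a * z" ..
  then have "b = a * rat_part z"
    by (simp add: zsqrt15_eq_iff of_int_zsqrt15)
  then show "a dvd b" ..
qed (auto simp: dvd_def)

definition sqrt15 :: zsqrt15 where
  "sqrt15 = ZSqrt15 0 1"

lemma sqrt15_mult_sqrt15: "sqrt15 * sqrt15 = 15"
proof -
  have "(15 :: zsqrt15) = of_int 15" by simp
  then show ?thesis
    by (simp only: of_int_zsqrt15) (simp add: zsqrt15_eq_iff sqrt15_def)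
qed

section \<open>Congruences in commutative rings\<close>

lemma dvd_mult_diff_mult:
  fixes q a b c d :: "'a::comm_ring_1"
  assumes "q dvd a - b" "q dvd c - d"
  shows "q dvd a * c - b * d"
proof -
  have "a * c - b * d = (a - b) * c + b * (c - d)" by (simp add: algebra_simps)
  then show ?thesis using assms by simp
qed

lemma dvd_power_diff_power:
  fixes q a b :: "'a::comm_ring_1"
  assumes "q dvd a - b"
  shows "q dvd a ^ n - b ^ n"
  by (induction n) (use assms in \<open>auto intro: dvd_mult_diff_mult\<close>)

text \<open>Zero divisors modulo q are possible, so u is cancelled by an explicit inverse v.\<close>

lemma dvd_diff_cancel_unit_mod:
  fixes q a b u v :: "'a::comm_ring_1"
  assumes "q dvd u * a - u * b" "q dvd v * u - 1"
  shows "q dvd a - b"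
proof -
  have "q dvd v * (u * a - u * b) - (v * u - 1) * (a - b)"
    by (rule dvd_diff[OF dvd_mult[OF assms(1)] dvd_mult2[OF assms(2)]])
  also have "v * (u * a - u * b) - (v * u - 1) * (a - b) = a - b" by (simp add: algebra_simps)
  finally show ?thesis .
qed

text \<open>All inner binomial coefficients of a prime row are multiples of p.\<close>

lemma prime_dvd_add_power_diff:
  fixes x y :: "'a::comm_ring_1"
  assumes p: "prime p"
  shows "of_nat p dvd (x + y) ^ p - (x ^ p + y ^ p)"
proof -
  let ?f = "\<lambda>k. of_nat (p choose k) * x ^ k * y ^ (p - k)"
  have p0: "p > 0" using p by (rule prime_gt_0_nat)
  have "{..p} = insert 0 (insert p {1..<p})" using p0 by auto
  then have "(x + y) ^ p = y ^ p + x ^ p + sum ?f {1..<p}"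
    using p0 by (simp add: binomial_ring)
  then have eq: "(x + y) ^ p - (x ^ p + y ^ p) = sum ?f {1..<p}" by simp
  have "of_nat p dvd ?f k" if "k \<in> {1..<p}" for k
  proof -
    have "p dvd p choose k" using that p by (intro dvd_choose_prime) auto
    then have "(of_nat p :: 'a) dvd of_nat (p choose k)" by (auto simp: dvd_def)
    then show ?thesis by simp
  qed
  then show ?thesis unfolding eq by (rule dvd_sum)
qed

lemma prime_dvd_power_self_diff:
  assumes p: "prime p"
  shows "int p dvd int c ^ p - int c"
proof (cases "p dvd c")
  case True
  then have "int p dvd int c" by simp
  moreover have "int c dvd int c ^ p" using prime_gt_0_nat[OF p] by (simp add: dvd_power)
  ultimately show ?thesis by (auto intro: dvd_trans)
next
  case False
  from fermat_theorem[OF p this] have "[int c ^ (p - 1) = 1] (mod int p)"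
    using cong_int_iff[of "c ^ (p - 1)" 1 p] by simp
  then have "int p dvd int c * (int c ^ (p - 1) - 1)" by (simp add: cong_iff_dvd_diff)
  moreover have "int c * (int c ^ (p - 1) - 1) = int c ^ p - int c"
    using prime_gt_0_nat[OF p] by (cases p) (simp_all add: algebra_simps)
  ultimately show ?thesis by simp
qed

text \<open>Fermat gives c^p = c modulo p, while sqrt15^p equals 15^((p-1)/2) sqrt15 exactly.
  Leaving this power of 15 unevaluated covers both values of the Legendre symbol.\<close>

lemma frobenius_zsqrt15:
  assumes p: "prime p" "odd p"
  shows "of_int (int p) dvd (of_int (int c) + sqrt15) ^ p
           - (of_int (int c) + of_int (15 ^ ((p - 1) div 2)) * sqrt15)"
proof -
  have "p = Suc (2 * ((p - 1) div 2))" using p(2) by presburger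
  then have "sqrt15 ^ p = sqrt15 ^ Suc (2 * ((p - 1) div 2))" by (rule arg_cong)
  also have "\<dots> = of_int (15 ^ ((p - 1) div 2)) * sqrt15"
    by (simp add: power_mult power2_eq_square sqrt15_mult_sqrt15)
  finally have r: "sqrt15 ^ p = of_int (15 ^ ((p - 1) div 2)) * sqrt15" .
  have "of_int (int p) dvd (of_int (int c ^ p - int c) :: zsqrt15)"
    unfolding of_int_dvd_of_int_zsqrt15_iff by (rule prime_dvd_power_self_diff) fact
  moreover have "of_int (int p) dvd
      (of_int (int c) + sqrt15) ^ p - (of_int (int c) ^ p + sqrt15 ^ p)"
    using prime_dvd_add_power_diff[OF p(1), of "of_int (int c)" sqrt15] by simp
  ultimately have "of_int (int p) dvd (of_int (int c) + sqrt15) ^ p - (of_int (int c) ^ p + sqrt15 ^ p)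
      + of_int (int c ^ p - int c)"
    by (rule dvd_add[rotated])
  then show ?thesis by (simp add: r algebra_simps)
qed

section \<open>Lucas sequences\<close>

lemma of_int_lucas_V:
  fixes a b :: "'a::comm_ring_1"
  assumes "a + b = of_int P" "a * b = of_int Q"
  shows "of_int (lucas_V P Q n) = a ^ n + b ^ n"
proof (induction n rule: induct_nat_012)
  case (ge2 n)
  have "of_int (lucas_V P Q (Suc (Suc n))) = (a + b) * (a ^ Suc n + b ^ Suc n) - a * b * (a ^ n + b ^ n)"
    by (simp only: lucas_V.simps of_int_diff of_int_mult ge2.IH assms)
  then show ?case by (simp add: algebra_simps)
qed (use assms in auto)

lemma of_int_S_seq:
  fixes a b :: "'a::comm_ring_1"
  assumes "of_int x = a + b" "a * b = 1"
  shows "of_int (S_seq x j) = a ^ (2 ^ j) + b ^ (2 ^ j)"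
proof (induction j)
  case (Suc j)
  have "a ^ (2 ^ j) * b ^ (2 ^ j) = 1"
    using assms(2) by (simp flip: power_mult_distrib)
  then have "(a ^ (2 ^ j) + b ^ (2 ^ j))\<^sup>2 - 2 = (a ^ (2 ^ j))\<^sup>2 + (b ^ (2 ^ j))\<^sup>2"
    by (simp add: power2_sum mult.assoc)
  then show ?case
    by (simp add: Suc mult.commute[of 2] flip: power_mult)
qed (use assms in simp)

section \<open>Elementary number theory\<close>

lemma nonresidue_mod_3:
  assumes "n mod 3 = (2::nat)"
  shows "\<not> QuadRes 3 (int n)"
proof
  assume "QuadRes 3 (int n)"
  then obtain y where "(y mod 3)\<^sup>2 mod 3 = int n mod 3"
    by (auto simp: QuadRes_def cong_def power_mod)
  moreover have "int n mod 3 = 2" using assms by presburger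
  moreover have "y mod 3 = 0 \<or> y mod 3 = 1 \<or> y mod 3 = 2" by presburger
  ultimately show False by (elim disjE) (simp_all del: power_mod)
qed

lemma nonresidue_mod_5:
  assumes "n mod 5 = (2::nat) \<or> n mod 5 = 3"
  shows "\<not> QuadRes 5 (int n)"
proof
  assume "QuadRes 5 (int n)"
  then obtain y where "(y mod 5)\<^sup>2 mod 5 = int n mod 5"
    by (auto simp: QuadRes_def cong_def power_mod)
  moreover have "int n mod 5 = 2 \<or> int n mod 5 = 3" using assms by presburger
  moreover have "y mod 5 = 0 \<or> y mod 5 = 1 \<or> y mod 5 = 2 \<or> y mod 5 = 3 \<or> y mod 5 = 4"
    by presburger
  ultimately show False by (elim disjE) (simp_all del: power_mod)
qed

text \<open>For p = 1 modulo 4 the sign in quadratic reciprocity is +1, so q is a nonresidue modulo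
  p, and Euler's criterion applies.\<close>

lemma nonresidue_power_minus_1:
  assumes p: "prime p" "p > 2" "[p = 1] (mod 4)" and q: "prime q" "q > 2" "p \<noteq> q"
    and nonres: "\<not> QuadRes (int q) (int p)"
  shows "[int q ^ ((p - 1) div 2) = -1] (mod int p)"
proof -
  have "even ((p - 1) div 2)" using p(2,3) unfolding cong_def by presburger
  then have "Legendre p q * Legendre q p = 1"
    using Quadratic_Reciprocity[of p q] p q by simp
  \<comment> \<open>The value 0 is excluded by the product being 1.\<close>
  moreover have "Legendre p q = 0 \<or> Legendre p q = -1" using nonres by (simp add: Legendre_def)
  ultimately have "Legendre q p = -1" by auto
  then show ?thesis using euler_criterion[of p "int q"] p by (simp add: cong_sym_eq)
qed

text \<open>If \<open>z\<close> is a primitive eighth root of unity modulo \<open>p\<close> then \<open>z - z\<^sup>3\<close> is a square root of 2.\<close>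
lemma two_power_eq_1:
  fixes c :: int
  assumes p: "prime p" "[p = 1] (mod 8)" and c: "[c ^ ((p - 1) div 2) = -1] (mod int p)"
  shows "[2 ^ ((p - 1) div 2) = 1] (mod int p)"
proof -
  have p2: "p > 2" using p prime_ge_2_nat[of p] by (cases "p = 2") (auto simp: cong_def)
  \<comment> \<open>With p = 8t + 1, the power c^t is the required root of unity: its fourth power
    is c^((p-1)/2) = -1.\<close>
  define t where "t = p div 8"
  define z where "z = c ^ t"
  have "p mod 8 = 1" using p(2) by (simp add: cong_def)
  then have "p = 8 * t + 1" using mult_div_mod_eq[of 8 p] unfolding t_def by linarith
  then have "(p - 1) div 2 = t * 4" by simp
  then have "z ^ 4 = c ^ ((p - 1) div 2)" by (simp add: z_def power_mult)
  then have "int p dvd z ^ 4 + 1" using c by (simp add: cong_iff_dvd_diff)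
  then have "int p dvd (z\<^sup>2 - 2) * (z ^ 4 + 1)" by simp
  also have "(z\<^sup>2 - 2) * (z ^ 4 + 1) = (z - z ^ 3)\<^sup>2 - 2" by (simp add: eval_nat_numeral algebra_simps)
  finally have "QuadRes p 2" by (auto simp: QuadRes_def cong_iff_dvd_diff)
  moreover have "\<not> [2 = 0] (mod int p)"
    using p2 by (auto simp: cong_iff_dvd_diff dest: zdvd_imp_le)
  ultimately have "Legendre 2 p = 1" by (simp add: Legendre_def)
  then show ?thesis using euler_criterion[of p 2] p(1) p2 by (simp add: cong_sym_eq)
qed

lemma exists_prime_factor_square_le:
  assumes "N > (1::nat)" "\<not> prime N"
  obtains p where "prime p" "p dvd N" "p * p \<le> N"
proof -
  obtain p where p: "prime p" "p dvd N" and le: "\<And>q. prime q \<Longrightarrow> q dvd N \<Longrightarrow> p \<le> q"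
    using assms(1) prime_factor_nat[of N] ex_has_least_nat[of "\<lambda>p. prime p \<and> p dvd N" _ id]
    by (metis id_apply less_irrefl)
  obtain q where q: "N = p * q" using p(2) ..
  have "q \<noteq> 1" using q p(1) assms(2) by auto
  then obtain s where s: "prime s" "s dvd q" using prime_factor_nat by blast
  have "q > 0" using q assms(1) by (cases q) auto
  then have "s \<le> q" using s(2) by (simp add: dvd_imp_le)
  moreover have "p \<le> s" using le s q by auto
  ultimately show ?thesis using that[OF p] q by simp
qed

text \<open>With M = 2^m, a composite N < M^2 has a prime factor p < M, which leaves only p = M - 1.
  The cofactor then forces a value of k that is negative, even or too large.\<close>

lemma prime_if_prime_factors_pm1_mod_power2:
  fixes k m N :: nat
  assumes m: "m > 1" and k: "odd k" "k < 2 ^ m" and N: "N = k * 2 ^ m + 1"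
    and pm1: "\<And>p. prime p \<Longrightarrow> p dvd N \<Longrightarrow> 2 ^ m dvd p - 1 \<or> 2 ^ m dvd p + 1"
  shows "prime N"
proof (rule ccontr)
  assume comp: "\<not> prime N"
  have "N > 1" using N k(1) by (auto elim: oddE)
  then obtain p where p: "prime p" "p dvd N" "p * p \<le> N"
    using comp by (rule exists_prime_factor_square_le)
  define M where "M = int (2 ^ m)"
  have M4: "M \<ge> 4" unfolding M_def using m power_increasing[of 2 m "2::int"] by simp
  have evenM: "even M" unfolding M_def using m by simp
  have kM: "int k < M" unfolding M_def using k(2) by simp
  have NM: "int N = int k * M + 1" unfolding N M_def by simp
  have p2: "p \<ge> 2" using p(1) by (rule prime_ge_2_nat)
  have "int k * M \<le> (M - 1) * M" using kM M4 by (intro mult_right_mono) auto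
  then have "int N < M * M" using NM M4 by (simp add: algebra_simps)
  then have "int p * int p < M * M" using p(3) by (metis of_nat_mult of_nat_le_iff order.strict_trans1)
  then have pM: "int p < M" using M4 mult_mono[of M "int p" M "int p"] by linarith
  have "\<not> 2 ^ m dvd p - 1"
  proof
    assume "2 ^ m dvd p - 1"
    then have "2 ^ m \<le> p - 1" using p2 by (intro dvd_imp_le) auto
    then show False using pM p2 unfolding M_def by linarith
  qed
  then have "2 ^ m dvd p + 1" using pm1 p by blast
  then have "2 ^ m \<le> p + 1" by (intro dvd_imp_le) auto
  then have pM1: "int p = M - 1" using pM unfolding M_def by linarith
  obtain q where "N = p * q" using p(2) ..
  then have eq: "int k * M + 1 = (M - 1) * int q" using NM pM1 by (metis of_nat_mult)
  \<comment> \<open>Solving kM + 1 = (M - 1)q for q gives q = Mc - 1 with this c, hence k = (M - 1)c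
    - 1. For c = 1 this is the even number M - 2; for c \<ge> 2 it is at least 2M - 3 > M.\<close>
  define c where "c = int q - int k"
  have q: "int q = M * c - 1" using eq unfolding c_def by (simp add: algebra_simps)
  have "M * int k = M * ((M - 1) * c - 1)" using eq unfolding q by (simp add: algebra_simps)
  then have kc: "int k = (M - 1) * c - 1" using M4 by simp
  consider "c \<le> 0" | "c = 1" | "c \<ge> 2" by linarith
  then show False
  proof cases
    case 1
    then have "(M - 1) * c \<le> 0" using M4 by (intro mult_nonneg_nonpos) auto
    then show ?thesis using kc by linarith
  next
    case 2
    then have "even (int k)" using kc evenM by simp
    then show ?thesis using k(1) by simp
  next
    case 3
    then have "(M - 1) * 2 \<le> (M - 1) * c" using M4 by (intro mult_left_mono) auto
    then have "(M - 1) * 2 \<le> int k + 1" unfolding kc by simp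
    then show ?thesis using kM M4 by (simp add: algebra_simps)
  qed
qed

text \<open>Write e = 2^j u with u odd. If j \<le> n, then e divides k 2^n u, so a to this exponent
  is 1; but it is also (-1)^u = -1, whence q divides 2.\<close>

lemma power2_dvd_if_power_eq_minus_1:
  fixes a :: "'a::comm_ring_1"
  assumes one: "q dvd a ^ e - 1" and minus: "q dvd a ^ (k * 2 ^ n) + 1"
    and q: "\<not> q dvd 2" and e: "e > 0"
  shows "2 ^ Suc n dvd e"
proof (rule ccontr)
  assume ndvd: "\<not> 2 ^ Suc n dvd e"
  obtain j u where u: "e = 2 ^ j * u" "odd u"
    using multiplicity_decompose'[of e 2] e by (metis not_gr_zero not_prime_unit two_is_prime_nat)
  have "j \<le> n"
    using ndvd unfolding u(1) by (metis dvd_mult2 le_imp_power_dvd not_less_eq_eq)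
  then obtain i where i: "n = j + i" using le_Suc_ex by blast
  have eq: "k * 2 ^ n * u = e * (k * 2 ^ i)"
    unfolding u(1) i by (simp add: power_add)
  then have "q dvd a ^ (k * 2 ^ n * u) - 1"
    using dvd_power_diff_power[OF one, of "k * 2 ^ i"]
    unfolding eq power_mult[of _ e] by simp
  moreover have "q dvd a ^ (k * 2 ^ n * u) + 1"
    using dvd_power_diff_power[of q "a ^ (k * 2 ^ n)" "-1" u] minus u(2)
    by (simp add: power_mult)
  ultimately have "q dvd (a ^ (k * 2 ^ n * u) + 1) - (a ^ (k * 2 ^ n * u) - 1)"
    by (rule dvd_diff[rotated])
  then show False using q by simp
qed

section \<open>The primality test\<close>

definition alpha :: zsqrt15 where "alpha = 4 + sqrt15"

definition beta :: zsqrt15 where "beta = 4 - sqrt15"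

lemma alpha_mult_beta: "alpha * beta = 1"
  by (simp add: alpha_def beta_def algebra_simps sqrt15_mult_sqrt15)

lemma ten_alpha: "10 * alpha = (5 + sqrt15)\<^sup>2"
  by (simp add: alpha_def power2_eq_square algebra_simps sqrt15_mult_sqrt15)

lemma of_int_S_seq_lucas_V:
  "of_int (S_seq (lucas_V 8 1 k) j) = alpha ^ (k * 2 ^ j) + beta ^ (k * 2 ^ j)"
proof -
  have "of_int (lucas_V 8 1 k) = alpha ^ k + beta ^ k"
    by (rule of_int_lucas_V) (simp_all add: alpha_mult_beta, simp add: alpha_def beta_def)
  then show ?thesis
    using of_int_S_seq[of _ "alpha ^ k" "beta ^ k"] alpha_mult_beta
    by (simp add: power_mult flip: power_mult_distrib)
qed

text \<open>Multiplying alpha^n + beta^n by the unit alpha^n, whose inverse is beta^n, gives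
  alpha^(2n) + 1.\<close>

lemma dvd_S_seq_lucas_V_iff:
  "int N dvd S_seq (lucas_V 8 1 k) j \<longleftrightarrow> of_int (int N) dvd alpha ^ (k * 2 ^ Suc j) + 1"
proof -
  let ?n = "k * 2 ^ j" and ?S = "of_int (S_seq (lucas_V 8 1 k) j) :: zsqrt15"
  have ab: "alpha ^ ?n * beta ^ ?n = 1"
    using alpha_mult_beta by (simp flip: power_mult_distrib)
  have "alpha ^ ?n * ?S = alpha ^ (2 * ?n) + 1"
    unfolding of_int_S_seq_lucas_V by (simp add: ab distrib_left mult_2 power_add)
  then have eq: "alpha ^ ?n * ?S = alpha ^ (k * 2 ^ Suc j) + 1" by (simp add: mult_ac)
  have "beta ^ ?n * (alpha ^ ?n * ?S) = (alpha ^ ?n * beta ^ ?n) * ?S" by (simp only: mult_ac)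
  then have "beta ^ ?n * (alpha ^ ?n * ?S) = ?S" by (simp only: ab mult_1)
  then have "of_int (int N) dvd alpha ^ ?n * ?S \<Longrightarrow> of_int (int N) dvd ?S"
    using dvd_mult[of "of_int (int N)" "alpha ^ ?n * ?S" "beta ^ ?n"] by (simp only:)
  then have "of_int (int N) dvd ?S \<longleftrightarrow> of_int (int N) dvd alpha ^ ?n * ?S"
    using dvd_mult by blast
  then show ?thesis unfolding eq of_int_dvd_of_int_zsqrt15_iff .
qed

text \<open>By Fermat e^2 = 1, so e = 1 or e = -1 modulo p. Frobenius accordingly sends
  \<open>alpha\<close> to itself or to its conjugate \<open>beta\<close>, which is its
  inverse.\<close>

lemma alpha_power_pm1:
  assumes p: "prime p" "odd p" and 15: "\<not> p dvd 15"
  shows "of_int (int p) dvd alpha ^ (p - 1) - 1 \<or> of_int (int p) dvd alpha ^ (p + 1) - 1"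
proof -
  define e where "e = (15::int) ^ ((p - 1) div 2)"
  have frob: "of_int (int p) dvd alpha ^ p - (4 + of_int e * sqrt15)"
    using frobenius_zsqrt15[OF p, of 4] by (simp add: alpha_def e_def)
  have "e * e = 15 ^ (p - 1)"
    using p(2) by (auto simp: e_def elim!: oddE simp flip: power_add mult_2)
  moreover have "[15 ^ (p - 1) = 1] (mod int p)"
    using fermat_theorem[OF p(1) 15] cong_int_iff[of "15 ^ (p - 1)" 1 p] by simp
  ultimately have "int p dvd (e - 1) * (e + 1)"
    by (simp add: cong_iff_dvd_diff algebra_simps)
  then consider "int p dvd e - 1" | "int p dvd e + 1"
    using p(1) prime_dvd_mult_iff by (metis prime_nat_int_transfer)
  then show ?thesis
  proof cases
    case 1
    then have "of_int (int p) dvd (of_int (e - 1) :: zsqrt15)"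
      by (simp only: of_int_dvd_of_int_zsqrt15_iff)
    then have "of_int (int p) dvd (alpha ^ p - (4 + of_int e * sqrt15)) + of_int (e - 1) * sqrt15"
      using frob by (intro dvd_add dvd_mult2)
    also have "(alpha ^ p - (4 + of_int e * sqrt15)) + of_int (e - 1) * sqrt15 = alpha ^ p - alpha"
      by (simp add: alpha_def algebra_simps)
    finally have "of_int (int p) dvd beta * (alpha ^ p - alpha)" by (rule dvd_mult)
    also have "beta * (alpha ^ p - alpha) = (alpha * beta) * (alpha ^ (p - 1) - 1)"
      using prime_gt_0_nat[OF p(1)] by (cases p) (simp_all add: algebra_simps)
    finally show ?thesis by (simp add: alpha_mult_beta)
  next
    case 2
    then have "of_int (int p) dvd (of_int (e + 1) :: zsqrt15)"
      by (simp only: of_int_dvd_of_int_zsqrt15_iff)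
    then have "of_int (int p) dvd (alpha ^ p - (4 + of_int e * sqrt15)) + of_int (e + 1) * sqrt15"
      using frob by (intro dvd_add dvd_mult2)
    also have "(alpha ^ p - (4 + of_int e * sqrt15)) + of_int (e + 1) * sqrt15 = alpha ^ p - beta"
      by (simp add: beta_def algebra_simps)
    finally have "of_int (int p) dvd alpha * (alpha ^ p - beta)" by (rule dvd_mult)
    then show ?thesis by (simp add: alpha_mult_beta right_diff_distrib)
  qed
qed

lemma alpha_power_minus_1_if_prime:
  assumes N: "prime N" "[N = 1] (mod 8)" "N mod 3 = 2" "N mod 5 = 2 \<or> N mod 5 = 3"
  shows "of_int (int N) dvd alpha ^ ((N - 1) div 2) + 1"
proof -
  define h where "h = (N - 1) div 2"
  have N8: "N mod 8 = 1" using N(2) by (simp add: cong_def)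
  have N5: "N > 5" using N(3) N8 by presburger
  have odd: "odd N" using N8 by presburger
  have h: "N = Suc (2 * h)" using odd unfolding h_def by presburger
  have cong4: "[N = 1] (mod 4)" using N8 unfolding cong_def by presburger
  have three: "[3 ^ h = -1] (mod int N)"
    using nonresidue_power_minus_1[of N 3] nonresidue_mod_3[OF N(3)] N N5 cong4
    by (simp add: h_def)
  have five: "[5 ^ h = -1] (mod int N)"
    using nonresidue_power_minus_1[of N 5] nonresidue_mod_5[OF N(4)] N N5 cong4
    by (simp add: h_def)
  have two: "[2 ^ h = 1] (mod int N)"
    \<comment> \<open>The nonresidue 3 supplies the eighth root of unity.\<close>
    using two_power_eq_1[OF N(1,2)] three unfolding h_def by blast
  have ten: "int N dvd 10 ^ h + 1"
    using cong_mult[OF two five] by (simp add: cong_iff_dvd_diff flip: power_mult_distrib)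
  have fifteen: "int N dvd 15 ^ h - 1"
    using cong_mult[OF three five] by (simp add: cong_iff_dvd_diff flip: power_mult_distrib)
  let ?N = "of_int (int N) :: zsqrt15" and ?g = "5 + sqrt15"
  have ten': "?N dvd 10 ^ h + 1"
    using ten of_int_dvd_of_int_zsqrt15_iff[of "int N" "10 ^ h + 1"] by simp
  have "?N dvd of_int (15 ^ h - 1)"
    using fifteen by (simp only: of_int_dvd_of_int_zsqrt15_iff)
  moreover have "?N dvd ?g ^ N - (5 + of_int (15 ^ h) * sqrt15)"
    using frobenius_zsqrt15[OF N(1) odd, of 5] by (simp add: h_def)
  ultimately have "?N dvd (?g ^ N - (5 + of_int (15 ^ h) * sqrt15)) + of_int (15 ^ h - 1) * sqrt15"
    by (intro dvd_add dvd_mult2)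
  then have "?N dvd ?g ^ N - ?g" by (simp add: algebra_simps)
  \<comment> \<open>The factor 5 + sqrt15 is not a unit of the ring; its conjugate turns it into its
    norm 10, which can be cancelled modulo N.\<close>
  then have "?N dvd (5 - sqrt15) * (?g ^ N - ?g)" by (rule dvd_mult)
  also have "(5 - sqrt15) * (?g ^ N - ?g) = (5 - sqrt15) * ?g * (?g ^ (2 * h) - 1)"
    by (simp add: h algebra_simps)
  also have "(5 - sqrt15) * ?g = 10"
    by (simp add: algebra_simps sqrt15_mult_sqrt15)
  finally have 1: "?N dvd 10 * ?g ^ (2 * h) - 10 * 1" by (simp add: right_diff_distrib)
  \<comment> \<open>As 10^h = -1 modulo N, the inverse of 10 is -10^(h-1), where h must be
    positive.\<close>
  have "h > 0" using h N5 by simp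
  then have "(- (10 ^ (h - 1))) * 10 - 1 = - (10 ^ h + 1 :: zsqrt15)"
    by (cases h) simp_all
  then have "?N dvd (- (10 ^ (h - 1))) * 10 - 1" using ten' by (simp only: dvd_minus_iff)
  with 1 have "?N dvd ?g ^ (2 * h) - 1" by (rule dvd_diff_cancel_unit_mod)
  then have "?N dvd 10 ^ h * alpha ^ h - 1"
    by (simp add: power_mult ten_alpha flip: power_mult_distrib)
  moreover have "?N dvd (10 ^ h + 1) * alpha ^ h" using ten' by (rule dvd_mult2)
  ultimately have "?N dvd (10 ^ h + 1) * alpha ^ h - (10 ^ h * alpha ^ h - 1)"
    by (rule dvd_diff[rotated])
  then show ?thesis by (simp add: h_def algebra_simps)
qed

text \<open>Modulo each prime p dividing N, the exponent k 2^(m-1) yields -1, so 2^m divides every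
  positive exponent that yields 1; p - 1 or p + 1 is one.\<close>

lemma prime_if_dvd_alpha_power_plus_1:
  assumes m: "m > 1" and k: "odd k" "k < 2 ^ m" and N: "N = k * 2 ^ m + 1"
    and 15: "coprime N 15" and dvd: "of_int (int N) dvd alpha ^ (k * 2 ^ (m - 1)) + 1"
  shows "prime N"
proof (rule prime_if_prime_factors_pm1_mod_power2[OF m k N])
  fix p assume p: "prime p" "p dvd N"
  have "odd N" using N m by simp
  then have odd: "odd p" using p(2) by auto
  have p15: "\<not> p dvd 15" using 15 p by (meson coprime_common_divisor not_prime_unit)
  have "of_int (int p) dvd (of_int (int N) :: zsqrt15)"
    using p(2) by (simp only: of_int_dvd_of_int_zsqrt15_iff of_nat_dvd_iff)
  then have pd: "of_int (int p) dvd alpha ^ (k * 2 ^ (m - 1)) + 1" using dvd by (rule dvd_trans)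
  have "\<not> int p dvd 2"
    using odd p(1) primes_dvd_imp_eq[of p 2] int_dvd_int_iff[of p 2] by auto
  then have p2: "\<not> of_int (int p) dvd (2 :: zsqrt15)"
    using of_int_dvd_of_int_zsqrt15_iff[of "int p" 2] by simp
  have p1: "p > 1" using p(1) by (rule prime_gt_1_nat)
  have order: "2 ^ m dvd e" if "of_int (int p) dvd alpha ^ e - 1" "e > 0" for e
    using power2_dvd_if_power_eq_minus_1[OF that(1) pd p2 that(2)] m by simp
  show "2 ^ m dvd p - 1 \<or> 2 ^ m dvd p + 1"
    using alpha_power_pm1[OF p(1) odd p15] order[of "p - 1"] order[of "p + 1"] p1
    by auto
qed

theorem theorem3p4:
  fixes m k N :: nat and x :: int
  assumes "m > 2" and "0 < k" and "k < 2 ^ m"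
    and "N = k * 2 ^ m + 1"
    and "([k = 1] (mod 6) \<and> ([k = 1] (mod 10) \<or> [k = 7] (mod 10)) \<and> [m = 0] (mod 4)) \<or>
         ([k = 5] (mod 6) \<and> ([k = 1] (mod 10) \<or> [k = 3] (mod 10)) \<and> [m = 1] (mod 4)) \<or>
         ([k = 1] (mod 6) \<and> ([k = 3] (mod 10) \<or> [k = 9] (mod 10)) \<and> [m = 2] (mod 4)) \<or>
         ([k = 5] (mod 6) \<and> ([k = 7] (mod 10) \<or> [k = 9] (mod 10)) \<and> [m = 3] (mod 4))"
    and "x = lucas_V 8 1 k"
  shows "prime N \<longleftrightarrow> int N dvd S_seq x (m - 2)"
proof -
  have "k mod 6 = 1 \<or> k mod 6 = 5" using assms(5) by (auto simp: cong_def)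
  then have oddk: "odd k" by presburger
  \<comment> \<open>Since 16 = 1 modulo 15, the residue of 2^m modulo 3 and modulo 5 depends only on
    m modulo 4.\<close>
  define w :: nat where "w = 2 ^ (m mod 4)"
  have "(2::nat) ^ m = 2 ^ (4 * (m div 4) + m mod 4)" by simp
  then have "(2::nat) ^ m = 16 ^ (m div 4) * w"
    unfolding w_def power_add power_mult by simp
  moreover have "[16 ^ (m div 4) = 1 ^ (m div 4)] (mod (15::nat))"
    by (rule cong_pow) (simp add: cong_def)
  ultimately have "[2 ^ m = w] (mod 15)" using cong_scalar_right by fastforce
  then have N15: "[N = k * w + 1] (mod 15)"
    unfolding assms(4) by (intro cong_add cong_mult) auto
  have Nmod: "N mod d = (k mod d * w + 1) mod d" if "d dvd 15" for d
  proof -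
    have "N mod d = (k * w + 1) mod d"
      using cong_dvd_modulus_nat[OF N15 that] by (simp add: cong_def)
    also have "\<dots> = (k mod d * w + 1) mod d"
      by (rule mod_add_cong) (simp_all add: mod_mult_left_eq)
    finally show ?thesis .
  qed
  have N3: "N mod 3 = (k mod 3 * w + 1) mod 3" and N5: "N mod 5 = (k mod 5 * w + 1) mod 5"
    by (rule Nmod, simp)+
  have "k mod 3 = k mod 6 mod 3" "k mod 5 = k mod 10 mod 5" by (simp_all add: mod_mod_cancel)
  then have N3': "N mod 3 = 2" and N5': "N mod 5 = 2 \<or> N mod 5 = 3"
    using assms(5) unfolding N3 N5 w_def by (auto simp: cong_def)
  have "\<not> 3 dvd N" "\<not> 5 dvd N" using N3' N5' by auto
  then have "coprime N (3 * 5)"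
    unfolding coprime_mult_right_iff by (simp add: coprime_commute[of N] prime_imp_coprime)
  then have cop: "coprime N 15" by simp
  \<comment> \<open>Here m > 2 enters: N = 1 modulo 8 makes 2 a residue when N is prime.\<close>
  have "2 ^ 3 dvd (2 ^ m :: nat)" using assms(1) by (intro le_imp_power_dvd) simp
  then have "8 dvd k * 2 ^ m" by simp
  then have N8: "[N = 1] (mod 8)" unfolding assms(4) by (auto simp: cong_def elim!: dvdE)
  \<comment> \<open>Passing from \<open>S_seq\<close> to a power of \<open>alpha\<close> doubles the
    exponent, so the index m - 2 leads to k 2^(m-1) = (N-1)/2.\<close>
  have m: "Suc (m - 2) = m - 1" "m = Suc (m - 1)" using assms(1) by auto
  have h: "(N - 1) div 2 = k * 2 ^ (m - 1)"
    unfolding assms(4) by (subst m(2)) simp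
  have "int N dvd S_seq x (m - 2) \<longleftrightarrow> of_int (int N) dvd alpha ^ (k * 2 ^ (m - 1)) + 1"
    unfolding assms(6) dvd_S_seq_lucas_V_iff m(1) ..
  then show ?thesis
    using alpha_power_minus_1_if_prime[OF _ N8 N3' N5'] h assms(1)
      prime_if_dvd_alpha_power_plus_1[OF _ oddk assms(3,4) cop] by auto
qed

end
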